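(* Let $q>2$ be a prime such that $q=5$ or $q\equiv\pm2\pmod 5$. Then $q$ has the Midy property in the golden ratio base $\tau=\frac{1+\sqrt5}{2}$.
   Context: For real $\beta>1$, the $\beta$-transformation is $T:[0,1]\to[0,1)$, $T(x)=\beta x-\lfloor \beta x\rfloor$. The $\beta$-expansion of $x\in(0,1)$ is $(x)_\beta=0.x_1x_2x_3\cdots$ with digits $x_i=\lfloor \beta T^{i-1}(x)\rfloor$, so that $x=\sum_{i\ge1}x_i\beta^{-i}$. It is purely periodic if the digit sequence $x_1x_2x_3\cdots$ equals $(c_1\cdots c_m)^\omega$ (infinite repetition of the block $c_1\cdots c_m$) for some $m\ge 1$. Midy property: $q\in\mathbb{N}$ has the Midy property in base $\beta$ if there exists a positive integer $p<q$ coprime with $q$ such that (a) the $\beta$-expansion of $p/q$ is purely periodic, $(p/q)_\beta=0.(c_1c_2\cdots c_{2n})^\omega$, where $2n$ (an even number, $n\ge1$) is the length of the shortest period; and (b) $x+y=\beta^n-1$, where $x=\sum_{i=1}^n c_i\beta^{n-i}$ and $y=\sum_{i=1}^n c_{n+i}\beta^{n-i}$. *)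

theory Defs
  imports Complex_Main "HOL-Number_Theory.Number_Theory"
begin

text \<open>Digits are indexed from 1; the value of \<open>beta_digit \<beta> x\<close> at index 0 is meaningless
  and never used.\<close>

definition beta_T :: "real \<Rightarrow> real \<Rightarrow> real" where
  "beta_T \<beta> x = \<beta> * x - of_int \<lfloor>\<beta> * x\<rfloor>"

definition beta_digit :: "real \<Rightarrow> real \<Rightarrow> nat \<Rightarrow> int" where
  "beta_digit \<beta> x i = \<lfloor>\<beta> * (beta_T \<beta> ^^ (i - 1)) x\<rfloor>"

text \<open>The sequence \<open>s 1, s 2, \<dots>\<close> is the infinite repetition of the nonempty block \<open>c\<close>; the list
  entry \<open>c ! (i - 1)\<close> is the block digit with index \<open>i\<close>.\<close>

definition is_repetition_of :: "(nat \<Rightarrow> int) \<Rightarrow> int list \<Rightarrow> bool" where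
  "is_repetition_of s c \<longleftrightarrow> c \<noteq> [] \<and> (\<forall>i\<ge>1. s i = c ! ((i - 1) mod length c))"

definition is_shortest_period :: "(nat \<Rightarrow> int) \<Rightarrow> int list \<Rightarrow> bool" where
  "is_shortest_period s c \<longleftrightarrow>
     is_repetition_of s c \<and> (\<forall>d. is_repetition_of s d \<longrightarrow> length c \<le> length d)"

definition midy_property :: "real \<Rightarrow> nat \<Rightarrow> bool" where
  "midy_property \<beta> q \<longleftrightarrow>
     (\<exists>p n c. 0 < p \<and> p < q \<and> coprime p q \<and> 1 \<le> n \<and>
        is_shortest_period (beta_digit \<beta> (real p / real q)) c \<and> length c = 2 * n \<and>
        (\<Sum>i=1..n. of_int (c ! (i - 1)) * \<beta> ^ (n - i)) +
        (\<Sum>i=1..n. of_int (c ! (n + i - 1)) * \<beta> ^ (n - i)) = \<beta> ^ n - 1)"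

definition golden_base :: real where
  "golden_base = (1 + sqrt 5) / 2"

end

theory Submission
  imports Defs
begin

text \<open>Write \<open>\<tau>\<close> for the golden ratio and let \<open>n \<ge> 1\<close> be minimal with \<open>\<tau>\<^sup>n\<close> congruent to \<open>- 1\<close> modulo
  \<open>q \<int>[\<tau>]\<close>; for inert \<open>q\<close> the exponent \<open>q + 1\<close> qualifies, and for \<open>q = 5\<close> the exponent \<open>10\<close> does.
  Take \<open>x = 1 / q\<close>. Then \<open>T\<^sup>n x + x\<close> lies in \<open>\<int>[\<tau>]\<close>. The orbit of a rational point, paired with its
  Galois conjugate, stays in the domain of the natural extension, and the resulting bounds on
  \<open>T\<^sup>n x + x\<close> and its conjugate force \<open>T\<^sup>n x = 1 - x\<close>. This is equivalent to the condition on the two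
  half-periods and gives the period \<open>2 n\<close>. Conversely a period \<open>m\<close> makes \<open>\<tau>\<^sup>m\<close> congruent to \<open>1\<close>, and
  the order of \<open>\<tau>\<close> modulo \<open>q\<close> is \<open>2 n\<close> by minimality of \<open>n\<close>.\<close>

section \<open>Arithmetic of the golden ratio\<close>

lemma golden_base_square: "golden_base * golden_base = golden_base + 1"
  by (simp add: golden_base_def field_simps)

lemma golden_base_bounds: "3/2 < golden_base" "golden_base < 17/10"
proof -
  have "2 < sqrt 5" by (rule real_less_rsqrt) simp
  then show "3/2 < golden_base" by (simp add: golden_base_def)
  have "sqrt 5 < 24/10" by (rule real_less_lsqrt) (simp_all add: power2_eq_square)
  then show "golden_base < 17/10" by (simp add: golden_base_def)
qed

text \<open>The threshold is \<open>1 / golden_base\<close>; on [0,1) it separates digit 0 from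
  digit 1.\<close>

lemma golden_base_less_iff: "golden_base * x < 1 \<longleftrightarrow> x < golden_base - 1"
proof -
  have "x < golden_base - 1 \<longleftrightarrow> golden_base * x < golden_base * (golden_base - 1)"
    using golden_base_bounds by simp
  then show ?thesis by (simp add: right_diff_distrib golden_base_square)
qed

lemma golden_base_irrational: "golden_base \<notin> \<rat>"
proof
  assume "golden_base \<in> \<rat>"
  then have "2 * golden_base - 1 \<in> \<rat>" by (intro Rats_diff Rats_mult) auto
  moreover have "2 * golden_base - 1 = sqrt (real 5)" by (simp add: golden_base_def field_simps)
  ultimately have "sqrt (real 5) \<in> \<rat>" by simp
  have "prime (5::nat)" by simp
  obtain m n :: nat where n: "n \<noteq> 0" and sqrt: "\<bar>sqrt (real 5)\<bar> = real m / real n"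
    and co: "coprime m n"
    using Rats_abs_nat_div_natE[OF \<open>sqrt (real 5) \<in> \<rat>\<close>] by metis
  have "real (m\<^sup>2) = (sqrt 5)\<^sup>2 * real (n\<^sup>2)"
  proof -
    have "real m = sqrt 5 * real n" using n sqrt by (simp add: field_simps)
    then show ?thesis by (simp only: of_nat_power power_mult_distrib)
  qed
  then have "real (m\<^sup>2) = real (5 * n\<^sup>2)" by simp
  then have eq: "m\<^sup>2 = 5 * n\<^sup>2" using of_nat_eq_iff by blast
  then have "5 dvd m" using prime_dvd_power[OF \<open>prime (5::nat)\<close>, of m 2] by simp
  then obtain k where "m = 5 * k" ..
  with eq have "5 * k\<^sup>2 = n\<^sup>2" by (simp add: power2_eq_square)
  then have "5 dvd n" using prime_dvd_power[OF \<open>prime (5::nat)\<close>, of n 2] by (metis dvd_triv_left)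
  with \<open>5 dvd m\<close> co have "is_unit (5::nat)" by (intro coprime_common_divisor)
  then show False by simp
qed

section \<open>The ring Z[\<tau>], conjugation and divisibility\<close>

text \<open>A relation on reals records membership in Z[\<tau>] and the conjugate at once;
  \<open>1 - golden_base\<close> is the second root of X^2 = X + 1.\<close>

definition golden_conj :: "real \<Rightarrow> real \<Rightarrow> bool" where
  "golden_conj u v \<longleftrightarrow>
     (\<exists>a b :: int. u = of_int a + of_int b * golden_base \<and>
        v = of_int a + of_int b * (1 - golden_base))"

lemma golden_conj_of_int: "golden_conj (of_int a) (of_int a)"
  unfolding golden_conj_def by (rule exI[of _ a], rule exI[of _ 0]) simp

lemma golden_conj_base: "golden_conj golden_base (1 - golden_base)"
  unfolding golden_conj_def by (rule exI[of _ 0], rule exI[of _ 1]) simp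

lemma golden_conj_add:
  assumes "golden_conj u u'" "golden_conj v v'"
  shows "golden_conj (u + v) (u' + v')"
proof -
  obtain a b c d where "u = of_int a + of_int b * golden_base"
    "u' = of_int a + of_int b * (1 - golden_base)"
    "v = of_int c + of_int d * golden_base"
    "v' = of_int c + of_int d * (1 - golden_base)"
    using assms unfolding golden_conj_def by blast
  then show ?thesis unfolding golden_conj_def
    by (intro exI[of _ "a + c"] exI[of _ "b + d"]) (simp add: algebra_simps)
qed

lemma golden_conj_mult:
  assumes "golden_conj u u'" "golden_conj v v'"
  shows "golden_conj (u * v) (u' * v')"
proof -
  obtain a b c d where eq: "u = of_int a + of_int b * golden_base"
    "u' = of_int a + of_int b * (1 - golden_base)"
    "v = of_int c + of_int d * golden_base"
    "v' = of_int c + of_int d * (1 - golden_base)"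
    using assms unfolding golden_conj_def by blast
  have "u * v = of_int (a*c + b*d) + of_int (a*d + b*c + b*d) * golden_base"
  proof -
    have "u * v = of_int (a*c) + of_int (a*d + b*c) * golden_base
        + of_int (b*d) * (golden_base * golden_base)"
      unfolding eq by (simp add: algebra_simps)
    then show ?thesis unfolding golden_base_square by (simp add: algebra_simps)
  qed
  moreover have "u' * v' = of_int (a*c + b*d) + of_int (a*d + b*c + b*d) * (1 - golden_base)"
  proof -
    have "u' * v' = of_int (a*c + a*d + b*c + b*d) - of_int (a*d + b*c + 2*b*d) * golden_base
        + of_int (b*d) * (golden_base * golden_base)"
      unfolding eq by (simp add: algebra_simps)
    then show ?thesis unfolding golden_base_square by (simp add: algebra_simps)
  qed
  ultimately show ?thesis unfolding golden_conj_def by blast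
qed

lemma golden_conj_diff:
  assumes "golden_conj u u'" "golden_conj v v'"
  shows "golden_conj (u - v) (u' - v')"
  using golden_conj_add[OF assms(1) golden_conj_mult[OF golden_conj_of_int[of "-1"] assms(2)]]
  by simp

lemma golden_conj_power: "golden_conj u u' \<Longrightarrow> golden_conj (u ^ k) (u' ^ k)"
  by (induction k) (use golden_conj_of_int[of 1] golden_conj_mult in auto)

text \<open>Irrationality of \<tau> makes coordinates unique, so conjugation is well
  defined.\<close>

lemma golden_conj_0_left:
  assumes "golden_conj 0 v"
  shows "v = 0"
proof -
  obtain a b :: int where ab: "0 = of_int a + of_int b * golden_base"
    "v = of_int a + of_int b * (1 - golden_base)"
    using assms unfolding golden_conj_def by blast
  have "b = 0"
  proof (rule ccontr)
    assume "b \<noteq> 0"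
    then have "golden_base = - of_int a / of_int b" using ab(1) by (simp add: field_simps)
    then show False using golden_base_irrational by (metis Rats_divide Rats_minus_iff Rats_of_int)
  qed
  with ab show ?thesis by simp
qed

text \<open>Divisibility by \<open>q\<close> in the ring of integers \<open>\<int>[\<tau>]\<close>, each element being given together with
  its conjugate.\<close>

definition golden_dvd :: "nat \<Rightarrow> real \<Rightarrow> real \<Rightarrow> bool" where
  "golden_dvd q u v \<longleftrightarrow> (\<exists>w w'. golden_conj w w' \<and> u = of_nat q * w \<and> v = of_nat q * w')"

lemma golden_dvd_add:
  "golden_dvd q u u' \<Longrightarrow> golden_dvd q v v' \<Longrightarrow> golden_dvd q (u + v) (u' + v')"
  unfolding golden_dvd_def by (metis golden_conj_add distrib_left)

lemma golden_dvd_diff: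
  "golden_dvd q u u' \<Longrightarrow> golden_dvd q v v' \<Longrightarrow> golden_dvd q (u - v) (u' - v')"
  unfolding golden_dvd_def by (metis golden_conj_diff right_diff_distrib)

lemma golden_dvd_mult:
  "golden_conj u u' \<Longrightarrow> golden_dvd q v v' \<Longrightarrow> golden_dvd q (u * v) (u' * v')"
  unfolding golden_dvd_def by (metis golden_conj_mult mult.left_commute)

lemma golden_dvd_sum:
  "(\<And>i. i \<in> A \<Longrightarrow> golden_dvd q (f i) (g i)) \<Longrightarrow> golden_dvd q (sum f A) (sum g A)"
proof (induction A rule: infinite_finite_induct)
  case (insert x F)
  then show ?case by (simp add: golden_dvd_add)
qed (use golden_conj_of_int[of 0] in \<open>auto simp: golden_dvd_def\<close>)

lemma golden_dvd_of_int:
  assumes "int q dvd a"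
  shows "golden_dvd q (of_int a) (of_int a)"
proof -
  obtain k where "a = int q * k" using assms by blast
  then show ?thesis unfolding golden_dvd_def using golden_conj_of_int[of k] by auto
qed

lemma golden_dvd_of_int_imp_dvd:
  assumes "golden_dvd q (of_int a) (of_int a)"
  shows "int q dvd a"
proof (cases "q = 0")
  case False
  obtain w w' where w: "golden_conj w w'" "of_int a = real q * w" "of_int a = real q * w'"
    using assms unfolding golden_dvd_def by blast
  \<comment> \<open>The quotient is fixed by conjugation, so its coefficient \<open>l\<close> at
    \<tau> must vanish.\<close>
  then have "w = w'" using False by (metis mult_left_cancel of_nat_eq_0_iff)
  then obtain k l :: int where kl: "w = of_int k + of_int l * golden_base"
    "w = of_int k + of_int l * (1 - golden_base)"
    using w(1) unfolding golden_conj_def by blast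
  then have "of_int l * (2 * golden_base - 1) = 0" by (simp add: algebra_simps)
  then have "l = 0" using golden_base_bounds by simp
  then have "real_of_int a = of_int (int q * k)" using w(2) kl by simp
  then show ?thesis using of_int_eq_iff by (metis dvd_triv_left)
qed (use assms in \<open>auto simp: golden_dvd_def\<close>)

text \<open>With \<open>q = 2 * h + 1\<close>, subtracting \<open>h * (2 * u)\<close> from
  \<open>q * u\<close> leaves \<open>u\<close>.\<close>

lemma golden_dvd_cancel_2:
  assumes "odd q" "golden_dvd q (2 * u) (2 * u')" "golden_conj u u'"
  shows "golden_dvd q u u'"
proof -
  obtain h where h: "q = 2 * h + 1" using assms(1) by (auto elim: oddE)
  have "golden_dvd q (of_int (int q) * u) (of_int (int q) * u')"
    unfolding golden_dvd_def using assms(3) by auto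
  from golden_dvd_diff[OF this golden_dvd_mult[OF golden_conj_of_int[of "int h"] assms(2)]]
  show ?thesis by (simp add: h algebra_simps)
qed

text \<open>If \<open>m < 2 * n\<close>, combining both congruences makes \<tau>^k congruent to -1
  for \<open>k = n - m\<close> or \<open>k = m - n\<close>, below the minimum \<open>n\<close>; for
  \<open>m = n\<close> it makes \<open>q\<close> divide 2.\<close>

lemma golden_dvd_base_order:
  assumes "golden_dvd q (golden_base ^ n + 1) ((1 - golden_base) ^ n + 1)"
    and minimal: "\<And>k. k \<ge> 1 \<Longrightarrow>
      golden_dvd q (golden_base ^ k + 1) ((1 - golden_base) ^ k + 1) \<Longrightarrow> n \<le> k"
    and m: "m \<ge> 1" "golden_dvd q (golden_base ^ m - 1) ((1 - golden_base) ^ m - 1)"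
    and "q > 2"
  shows "2 * n \<le> m"
proof (rule ccontr)
  assume "\<not> 2 * n \<le> m"
  then consider "m < n" | "m = n" | "n < m" "m < 2 * n" by linarith
  then show False
  proof cases
    case 1
    from golden_dvd_diff[OF assms(1) golden_dvd_mult[OF golden_conj_power[OF golden_conj_base] m(2)], of "n - m"]
    have "golden_dvd q (golden_base ^ (n - m) + 1) ((1 - golden_base) ^ (n - m) + 1)"
      using 1 by (simp add: right_diff_distrib add.commute flip: power_add)
    then have "n \<le> n - m" using 1 by (intro minimal) auto
    then show False using 1 m(1) by simp
  next
    case 2
    from golden_dvd_diff[OF assms(1) m(2)] have "golden_dvd q (of_int 2) (of_int 2)"
      by (simp add: 2)
    then have "int q dvd 2" by (rule golden_dvd_of_int_imp_dvd)
    then show False using \<open>q > 2\<close> zdvd_imp_le by fastforce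
  next
    case 3
    from golden_dvd_diff[OF golden_dvd_mult[OF golden_conj_power[OF golden_conj_base] assms(1)] m(2), of "m - n"]
    have "golden_dvd q (golden_base ^ (m - n) + 1) ((1 - golden_base) ^ (m - n) + 1)"
      using 3 by (simp add: distrib_left flip: power_add)
    then have "n \<le> m - n" using 3 by (intro minimal) auto
    then show False using 3 by simp
  qed
qed

section \<open>Iterates, digits and the golden natural extension\<close>

lemma beta_T_iterate_bounds:
  assumes "0 \<le> x" "x < 1"
  shows "0 \<le> (beta_T \<beta> ^^ i) x" "(beta_T \<beta> ^^ i) x < 1"
  using assms by (cases i; simp add: beta_T_def; linarith)+

lemma beta_T_digit:
  "i \<ge> 1 \<Longrightarrow> (beta_T \<beta> ^^ i) x = \<beta> * (beta_T \<beta> ^^ (i - 1)) x - of_int (beta_digit \<beta> x i)"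
  by (cases i) (auto simp: beta_T_def beta_digit_def)

lemma beta_digit_add:
  "i \<ge> 1 \<Longrightarrow> beta_digit \<beta> x (k + i) = beta_digit \<beta> ((beta_T \<beta> ^^ k) x) i"
  by (cases i) (auto simp: beta_digit_def add.commute[of k] funpow_add)

text \<open>Horner's scheme for the recursion \<open>beta_T_digit\<close>; it evaluates the digit
  blocks of the Midy condition through iterates.\<close>

lemma beta_T_digit_sum:
  "(\<Sum>i=1..n. of_int (beta_digit \<beta> x i) * \<beta> ^ (n - i)) = \<beta> ^ n * x - (beta_T \<beta> ^^ n) x"
proof (induction n)
  case (Suc n)
  have "(\<Sum>i=1..n. of_int (beta_digit \<beta> x i) * \<beta> ^ (Suc n - i))
      = \<beta> * (\<Sum>i=1..n. of_int (beta_digit \<beta> x i) * \<beta> ^ (n - i))"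
    unfolding sum_distrib_left by (intro sum.cong) (auto simp: Suc_diff_le)
  also have "\<dots> = \<beta> * (\<beta> ^ n * x - (beta_T \<beta> ^^ n) x)" by (simp only: Suc)
  finally show ?case using beta_T_digit[of "Suc n" \<beta> x] by (simp add: algebra_simps)
qed simp

text \<open>While digits agree, each step multiplies the distance by \<beta>, yet both orbits stay
  in [0,1). This turns a period of the digits into a period of the orbit.\<close>

lemma beta_digit_inject:
  assumes "\<beta> > 1" "0 \<le> x" "x < 1" "0 \<le> y" "y < 1"
    and "\<And>i. i \<ge> 1 \<Longrightarrow> beta_digit \<beta> x i = beta_digit \<beta> y i"
  shows "x = y"
proof (rule ccontr)
  assume "x \<noteq> y"
  then obtain k where k: "1 / \<bar>x - y\<bar> < \<beta> ^ k" using real_arch_pow[OF assms(1)] by blast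
  have "(\<Sum>i=1..k. of_int (beta_digit \<beta> x i) * \<beta> ^ (k - i))
      = (\<Sum>i=1..k. of_int (beta_digit \<beta> y i) * \<beta> ^ (k - i))"
    using assms(6) by (intro sum.cong) auto
  then have "(beta_T \<beta> ^^ k) x - (beta_T \<beta> ^^ k) y = \<beta> ^ k * (x - y)"
    unfolding beta_T_digit_sum by (simp add: algebra_simps)
  moreover have "\<bar>(beta_T \<beta> ^^ k) x - (beta_T \<beta> ^^ k) y\<bar> < 1"
    using beta_T_iterate_bounds[of x k \<beta>] beta_T_iterate_bounds[of y k \<beta>] assms by linarith
  ultimately have "\<beta> ^ k * \<bar>x - y\<bar> < 1" using assms(1) by (simp add: abs_mult)
  with k \<open>x \<noteq> y\<close> show False by (simp add: field_simps)
qed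

text \<open>The conditions on \<open>v\<close> describe the domain of the natural extension of the golden
  \<open>\<beta>\<close>-transformation, where \<open>v\<close> is the Galois conjugate of the current point.\<close>

lemma golden_natural_extension:
  assumes "0 < x" "x < 1"
  shows "\<exists>v. golden_conj ((beta_T golden_base ^^ i) x - golden_base ^ i * x)
                         (v - (1 - golden_base) ^ i * x) \<and>
    v < 1 \<and> - golden_base < v \<and>
    (golden_base - 1 \<le> (beta_T golden_base ^^ i) x \<longrightarrow> 1 - golden_base < v)"
proof (induction i)
  case 0
  show ?case
    \<comment> \<open>The rational \<open>x\<close> is its own conjugate, and
      \<open>1 - golden_base\<close> is negative.\<close>
    by (rule exI[of _ x]) (use assms golden_base_bounds golden_conj_of_int[of 0] in auto)
next
  case (Suc i)
  let ?t = golden_base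
  define X where "X = (beta_T ?t ^^ i) x"
  have X: "0 \<le> X" "X < 1" using beta_T_iterate_bounds[of x] assms by (auto simp: X_def)
  obtain v where v: "golden_conj (X - ?t ^ i * x) (v - (1 - ?t) ^ i * x)"
    "v < 1" "- ?t < v" "?t - 1 \<le> X \<longrightarrow> 1 - ?t < v"
    using Suc unfolding X_def by blast
  define d where "d = \<lfloor>?t * X\<rfloor>"
  have TX: "(beta_T ?t ^^ Suc i) x = ?t * X - of_int d" by (simp add: beta_T_def X_def d_def)
  have "golden_conj (?t * (X - ?t ^ i * x) - of_int d)
      ((1 - ?t) * (v - (1 - ?t) ^ i * x) - of_int d)"
    by (intro golden_conj_diff golden_conj_mult golden_conj_base golden_conj_of_int v(1))
  then have "golden_conj ((beta_T ?t ^^ Suc i) x - ?t ^ Suc i * x)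
      (((1 - ?t) * v - of_int d) - (1 - ?t) ^ Suc i * x)"
    unfolding TX by (simp add: algebra_simps)
  moreover have "(1 - ?t) * v - of_int d < 1 \<and> - ?t < (1 - ?t) * v - of_int d \<and>
    (?t - 1 \<le> ?t * X - of_int d \<longrightarrow> 1 - ?t < (1 - ?t) * v - of_int d)"
  proof (cases "X < ?t - 1")
    case True
    have "d = 0" unfolding d_def
      using golden_base_less_iff[of X] True X golden_base_bounds by (simp add: floor_eq_iff)
    \<comment> \<open>As \<tau>(\<tau> - 1) = 1, the new conjugate lies between 1 - \<tau> and
      1.\<close>
    have "(?t - 1) * (- ?t) < (?t - 1) * v" "(?t - 1) * v < (?t - 1) * 1"
      using v golden_base_bounds by (simp_all only: mult_less_cancel_left_pos)
    then show ?thesis using golden_base_square golden_base_bounds \<open>d = 0\<close>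
      by (simp add: algebra_simps)
  next
    case False
    have "?t * X < ?t * 1" using X golden_base_bounds by (intro mult_strict_left_mono) auto
    then have "?t * X < 2" using golden_base_bounds by linarith
    then have "d = 1" unfolding d_def
      using golden_base_less_iff[of X] False by (simp add: floor_eq_iff)
    have "(?t - 1) * (1 - ?t) < (?t - 1) * v" "(?t - 1) * v < (?t - 1) * 1"
      using v False golden_base_bounds by (simp_all add: mult_less_cancel_left_pos)
    \<comment> \<open>After digit 1 the next point is below \<tau> - 1, so the last condition is
      vacuous.\<close>
    moreover have "?t * X < ?t" using \<open>?t * X < ?t * 1\<close> by simp
    ultimately show ?thesis using golden_base_square golden_base_bounds \<open>d = 1\<close>
      by (simp add: algebra_simps)
  qed
  ultimately show ?case unfolding TX by blast
qed

text \<open>The sum of \<open>x\<close> and its \<open>n\<close>-th iterate lies in \<open>\<int>[\<tau>]\<close>, and the bounds on it and on its conjugate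
  leave \<open>1\<close> as the only possibility.\<close>

lemma golden_iterate_complement:
  assumes n: "golden_dvd q (golden_base ^ n + 1) ((1 - golden_base) ^ n + 1)"
    and p: "0 < p" "p < q" and x: "x = real p / real q"
  shows "(beta_T golden_base ^^ n) x = 1 - x"
proof -
  let ?t = golden_base
  define X where "X = (beta_T ?t ^^ n) x"
  have x01: "0 < x" "x < 1" using p by (simp_all add: x)
  have X: "0 \<le> X" "X < 1" using beta_T_iterate_bounds[of x] x01 by (auto simp: X_def)
  obtain v where v: "golden_conj (X - ?t ^ n * x) (v - (1 - ?t) ^ n * x)"
    "v < 1" "- ?t < v" "?t - 1 \<le> X \<longrightarrow> 1 - ?t < v"
    using golden_natural_extension[OF x01, of n] unfolding X_def by blast
  obtain w w' where w: "golden_conj w w'" "?t ^ n = real q * w - 1" "(1 - ?t) ^ n = real q * w' - 1"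
    using n unfolding golden_dvd_def by (metis add_diff_cancel_right')
  \<comment> \<open>Since \<open>x = p / q\<close>, the product \<tau>^n x equals
    \<open>p * w - x\<close>; adding \<open>p * w\<close> therefore leaves
    \<open>X + x\<close>.\<close>
  have *: "golden_conj ((X - ?t ^ n * x) + of_int (int p) * w)
      ((v - (1 - ?t) ^ n * x) + of_int (int p) * w')"
    by (intro golden_conj_add golden_conj_mult golden_conj_of_int v w)
  have "golden_conj (X + x) (v + x)"
  proof -
    have "?t ^ n * x = of_int (int p) * w - x" "(1 - ?t) ^ n * x = of_int (int p) * w' - x"
      using p by (simp_all add: w(2,3) x field_simps)
    then show ?thesis using * by simp
  qed
  then obtain a b :: int where ab: "X + x = of_int a + of_int b * ?t"
      "v + x = of_int a + of_int b * (1 - ?t)"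
    unfolding golden_conj_def by blast
  \<comment> \<open>\<open>s\<close> is the square root of 5, and \<open>X - v = b * s\<close> lies
    strictly between -1 and 1 + \<tau>; hence \<open>b\<close> is 0 or 1.\<close>
  define s where "s = 2 * ?t - 1"
  have s: "s > 2" "2 * s > 1 + ?t" using golden_base_bounds by (simp_all add: s_def)
  have "X - v = of_int b * s" using ab by (simp add: s_def algebra_simps)
  then have bs: "- 1 < of_int b * s" "of_int b * s < 1 + ?t" using X v by linarith+
  have "b \<ge> 0"
  proof (rule ccontr)
    assume "\<not> b \<ge> 0"
    then have "of_int b * s \<le> (-1) * s" using s by (intro mult_right_mono) linarith+
    then show False using bs s by simp
  qed
  moreover have "b < 2"
  proof (rule ccontr)
    assume "\<not> b < 2"
    then have "2 * s \<le> of_int b * s" using s by (intro mult_right_mono) linarith+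
    then show False using bs s by linarith
  qed
  ultimately consider "b = 0" | "b = 1" by linarith
  then show ?thesis
  proof cases
    case 1
    then have "0 < real_of_int a" "real_of_int a < 2" using ab X x01 by simp_all
    then have "a = 1" by linarith
    then show ?thesis using 1 ab by (simp add: X_def)
  next
    case 2
    then have "-2 < real_of_int a" "real_of_int a < 1" using ab X x01 golden_base_bounds by simp_all
    then consider "a = - 1" | "a = 0" by linarith
    \<comment> \<open>For \<open>a = -1\<close>, \<open>v = - ?t - x\<close> is too small. For
      \<open>a = 0\<close>, \<open>X = ?t - x\<close> exceeds \<tau> - 1 while
      \<open>v = 1 - ?t - x\<close> is below 1 - \<tau>.\<close>
    then have False
    proof cases
      case 1
      then show False using 2 ab v x01 by simp
    next
      case a0: 2
      then show False using 2 ab v x01 X by simp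
    qed
    then show ?thesis ..
  qed
qed

section \<open>Exponents with \<tau>^k congruent to -1 modulo \<open>q\<close>\<close>

text \<open>Neither 2 nor 3 is a square modulo 5. The sign in quadratic reciprocity is +1, so 5 is a
  nonresidue modulo \<open>q\<close>, and Euler's criterion applies.\<close>

lemma five_power_half:
  fixes q :: nat
  assumes "prime q" "q > 2" "[int q = 2] (mod 5) \<or> [int q = - 2] (mod 5)"
  shows "[5 ^ ((q - 1) div 2) = - 1] (mod int q)"
proof -
  have m: "int q mod 5 = 2 \<or> int q mod 5 = 3" using assms(3) by (auto simp: cong_def)
  then have "q \<noteq> 5" by auto
  have "\<not> QuadRes 5 (int q)"
  proof
    assume "QuadRes 5 (int q)"
    then obtain y where y: "[y\<^sup>2 = int q] (mod 5)" unfolding QuadRes_def by blast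
    have "y mod 5 = 0 \<or> y mod 5 = 1 \<or> y mod 5 = 2 \<or> y mod 5 = 3 \<or> y mod 5 = 4"
      by presburger
    then have "(y mod 5)\<^sup>2 mod 5 \<noteq> 2 \<and> (y mod 5)\<^sup>2 mod 5 \<noteq> 3" by (elim disjE) simp_all
    then have "y\<^sup>2 mod 5 \<noteq> 2 \<and> y\<^sup>2 mod 5 \<noteq> 3" unfolding power_mod .
    then show False using y m by (auto simp: cong_def)
  qed
  moreover have "\<not> [int q = 0] (mod 5)" using m by (auto simp: cong_def)
  ultimately have "Legendre (int q) 5 = - 1" by (simp add: Legendre_def)
  moreover have "Legendre (int q) (int 5) * Legendre (int 5) (int q)
      = (- 1) ^ ((q - 1) div 2 * ((5 - 1) div 2))"
    using Quadratic_Reciprocity[of q 5] assms \<open>q \<noteq> 5\<close> by (simp add: mult.commute)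
  ultimately have "Legendre 5 (int q) = - 1" by (simp add: minus_one_power_iff)
  then show ?thesis using euler_criterion[of q 5] assms(1,2) by (simp add: cong_sym_eq)
qed

text \<open>The inner binomial coefficients of a prime exponent are divisible by it.\<close>

lemma golden_dvd_one_plus_sqrt5_power:
  assumes "prime q"
  shows "golden_dvd q ((1 + sqrt 5) ^ q - 1 - sqrt 5 ^ q) ((1 - sqrt 5) ^ q - 1 - (- sqrt 5) ^ q)"
proof -
  have sqrt5: "golden_conj (sqrt 5) (- sqrt 5)"
    unfolding golden_conj_def
    by (rule exI[of _ "-1"], rule exI[of _ 2]) (simp add: golden_base_def field_simps)
  have split: "(1 + s) ^ q - 1 - s ^ q = (\<Sum>k\<in>{0<..<q}. of_nat (q choose k) * s ^ k)" for s :: real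
  proof -
    have "(1 + s) ^ q = (\<Sum>k\<le>q. of_nat (q choose k) * s ^ k)"
      using binomial_ring[of s 1 q] by (simp add: add.commute)
    also have "{..q} = insert 0 (insert q {0<..<q})" using prime_gt_0_nat[OF assms] by auto
    finally show ?thesis using prime_gt_0_nat[OF assms] by simp
  qed
  have "golden_dvd q (\<Sum>k\<in>{0<..<q}. of_nat (q choose k) * sqrt 5 ^ k)
      (\<Sum>k\<in>{0<..<q}. of_nat (q choose k) * (- sqrt 5) ^ k)"
  proof (rule golden_dvd_sum)
    fix k assume "k \<in> {0<..<q}"
    then have "q dvd q choose k" using assms by (intro dvd_choose_prime) auto
    then have "golden_dvd q (of_int (int (q choose k))) (of_int (int (q choose k)))"
      by (intro golden_dvd_of_int) simp
    from golden_dvd_mult[OF golden_conj_power[OF sqrt5] this]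
    show "golden_dvd q (of_nat (q choose k) * sqrt 5 ^ k) (of_nat (q choose k) * (- sqrt 5) ^ k)"
      by (simp add: mult.commute)
  qed
  then show ?thesis using split[of "sqrt 5"] split[of "- sqrt 5"] by simp
qed

text \<open>For inert \<open>q\<close> the Frobenius map is conjugation, so \<open>\<tau>\<^sup>q\<^sup>+\<^sup>1\<close> is congruent to the
  norm \<open>- 1\<close> of \<open>\<tau>\<close>.\<close>

lemma golden_dvd_base_power_inert:
  fixes q :: nat
  assumes "prime q" "q > 2" "[int q = 2] (mod 5) \<or> [int q = - 2] (mod 5)"
  shows "golden_dvd q (golden_base ^ (q + 1) + 1) ((1 - golden_base) ^ (q + 1) + 1)"
proof -
  let ?t = golden_base
  have "odd q" using assms(1,2) prime_odd_nat by auto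
  then obtain h where h: "q = 2 * h + 1" by (auto elim: oddE)
  have t: "1 + sqrt 5 = 2 * ?t" "1 - sqrt 5 = 2 * (1 - ?t)" "sqrt 5 = 2 * ?t - 1"
    by (simp_all add: golden_base_def field_simps)
  have base: "golden_conj ?t (1 - ?t)" "golden_conj (1 - ?t) ?t"
    using golden_conj_diff[OF golden_conj_of_int[of 1] golden_conj_base] golden_conj_base by auto
  have "int q dvd 5 ^ h + 1"
    using five_power_half[OF assms] by (simp add: h cong_iff_dvd_diff)
  then have "golden_dvd q (of_int (5 ^ h + 1)) (of_int (5 ^ h + 1))"
    by (rule golden_dvd_of_int)
  from golden_dvd_mult[OF golden_conj_diff[OF base(1) base(2)] this]
  have 5: "golden_dvd q (sqrt 5 ^ q + sqrt 5) ((- sqrt 5) ^ q + (- sqrt 5))"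
    by (simp add: h power_mult t(3)[symmetric]) (simp add: t(3) algebra_simps)
  have "[2 ^ q = 2] (mod q)"
  proof -
    have "\<not> q dvd 2" using assms(2) dvd_imp_le by fastforce
    then have "[2 ^ (q - 1) = 1] (mod q)" using fermat_theorem assms(1) by blast
    then have "[2 * 2 ^ (q - 1) = 2 * 1] (mod q)" by (rule cong_scalar_left)
    then show ?thesis using assms(2) by (simp flip: power_Suc)
  qed
  then have "[int (2 ^ q) = int 2] (mod int q)" by (simp only: cong_int_iff)
  then have "int q dvd 2 ^ q - 2" by (simp add: cong_iff_dvd_diff)
  then have "golden_dvd q (of_int (2 ^ q - 2)) (of_int (2 ^ q - 2))" by (rule golden_dvd_of_int)
  from golden_dvd_mult[OF golden_conj_power[OF base(1)] this]
  have 2: "golden_dvd q (?t ^ q * (2 ^ q - 2)) ((1 - ?t) ^ q * (2 ^ q - 2))" by simp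
  \<comment> \<open>Modulo \<open>q\<close>: 2\<tau>^q is (2\<tau>)^q, which is
    \<open>1 + sqrt 5 ^ q\<close>, and this is \<open>1 - sqrt 5\<close>, twice the conjugate of
    \<tau>.\<close>
  have "golden_dvd q (2 * (?t ^ q - (1 - ?t))) (2 * ((1 - ?t) ^ q - ?t))"
    using golden_dvd_diff[OF golden_dvd_add[OF golden_dvd_one_plus_sqrt5_power[OF assms(1)] 5] 2]
    unfolding t(1,2) power_mult_distrib by (simp add: t(3) algebra_simps)
  then have "golden_dvd q (?t ^ q - (1 - ?t)) ((1 - ?t) ^ q - ?t)"
    by (rule golden_dvd_cancel_2[OF \<open>odd q\<close>]) (intro golden_conj_diff golden_conj_power base)
  from golden_dvd_mult[OF base(1) this] show ?thesis
    using golden_base_square by (simp add: algebra_simps)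
qed

text \<open>Squaring \<tau>^5 = 5\<tau> + 3 gives \<tau>^10 = 55\<tau> + 34. Only s^2 = s + 1 is
  used, so the conjugate is covered too.\<close>

lemma golden_dvd_base_power_5: "golden_dvd 5 (golden_base ^ 10 + 1) ((1 - golden_base) ^ 10 + 1)"
proof -
  have pow: "s ^ 10 + 1 = 5 * (7 + 11 * s)" if "s * s = s + 1" for s :: real
  proof -
    have "s ^ 10 = ((s * s) * (s * s) * s) * ((s * s) * (s * s) * s)"
      by (simp add: numeral_eq_Suc)
    also have "(s * s) * (s * s) * s = 5 * s + 3"
    proof -
      have "(s * s) * (s * s) * s = (s + 1) * (s + 1) * s" using that by simp
      also have "\<dots> = (s * s) * s + 2 * (s * s) + s" by (simp add: algebra_simps)
      also have "\<dots> = (s + 1) * s + 2 * (s + 1) + s" by (simp only: that)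
      also have "\<dots> = s * s + 4 * s + 2" by (simp add: algebra_simps)
      finally show ?thesis using that by linarith
    qed
    also have "(5 * s + 3) * (5 * s + 3) = 25 * (s * s) + 30 * s + 9" by (simp add: algebra_simps)
    also have "\<dots> = 55 * s + 34" by (simp add: that)
    finally show ?thesis by simp
  qed
  have "golden_conj (7 + 11 * golden_base) (7 + 11 * (1 - golden_base))"
    unfolding golden_conj_def by (rule exI[of _ 7], rule exI[of _ 11]) simp
  moreover have "(1 - golden_base) * (1 - golden_base) = (1 - golden_base) + 1"
    using golden_base_square by (simp add: algebra_simps)
  ultimately show ?thesis
    unfolding golden_dvd_def pow[OF golden_base_square] using pow by fastforce
qed

section \<open>The expansion of 1/q\<close>

theorem theorem5p3:
  fixes q :: nat
  assumes "prime q" and "q > 2"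
    and "q = 5 \<or> [int q = 2] (mod 5) \<or> [int q = - 2] (mod 5)"
  shows "midy_property golden_base q"
proof -
  let ?t = golden_base
  define P where "P k \<longleftrightarrow> k \<ge> 1 \<and> golden_dvd q (?t ^ k + 1) ((1 - ?t) ^ k + 1)" for k :: nat
  have "\<exists>k. P k"
  proof (cases "q = 5")
    case True
    then show ?thesis using golden_dvd_base_power_5 unfolding P_def by (intro exI[of _ 10]) simp
  next
    case False
    then show ?thesis using golden_dvd_base_power_inert[of q] assms unfolding P_def
      by (intro exI[of _ "q + 1"]) simp
  qed
  define n where "n = Least P"
  have "P n" using \<open>\<exists>k. P k\<close> unfolding n_def by (rule LeastI_ex)
  then have n: "n \<ge> 1" "golden_dvd q (?t ^ n + 1) ((1 - ?t) ^ n + 1)" by (simp_all add: P_def)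
  have minimal: "n \<le> k" if "k \<ge> 1" "golden_dvd q (?t ^ k + 1) ((1 - ?t) ^ k + 1)" for k
    unfolding n_def using that by (intro Least_le) (simp add: P_def)
  define x where "x = real 1 / real q"
  have x01: "0 < x" "x < 1" using assms(2) by (simp_all add: x_def)
  have Tn: "(beta_T ?t ^^ n) x = 1 - x"
    using golden_iterate_complement[OF n(2) _ _ x_def] assms(2) by simp
  \<comment> \<open>The complement is again a fraction with denominator \<open>q\<close>, so another
    \<open>n\<close> steps lead back to \<open>x\<close>.\<close>
  have "1 - x = real (q - 1) / real q" using assms(2) by (simp add: x_def field_simps)
  then have "(beta_T ?t ^^ n) (1 - x) = x"
    using golden_iterate_complement[OF n(2), of "q - 1" "1 - x"] assms(2) by simp
  then have T2n: "(beta_T ?t ^^ (2 * n)) x = x" using Tn by (simp add: mult_2 funpow_add)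
  define c where "c = map (\<lambda>i. beta_digit ?t x (Suc i)) [0..<2 * n]"
  have c: "length c = 2 * n" "\<And>i. i < 2 * n \<Longrightarrow> c ! i = beta_digit ?t x (Suc i)"
    by (simp_all add: c_def)
  have "beta_digit ?t x (Suc (j mod (2 * n))) = beta_digit ?t x (Suc j)" for j
    using funpow_mod_eq[OF T2n, of j] by (simp add: beta_digit_def)
  then have rep: "is_repetition_of (beta_digit ?t x) c"
    unfolding is_repetition_of_def using n(1) c by auto
  moreover have "2 * n \<le> length d" if d: "is_repetition_of (beta_digit ?t x) d" for d
  proof -
    define m where "m = length d"
    have "m \<ge> 1" using d by (simp add: is_repetition_of_def m_def Suc_leI)
    have "beta_digit ?t x i = beta_digit ?t ((beta_T ?t ^^ m) x) i" if "i \<ge> 1" for i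
    proof -
      have "beta_digit ?t x (m + i) = beta_digit ?t x i"
        using d that \<open>m \<ge> 1\<close> unfolding is_repetition_of_def m_def[symmetric]
        by (metis Nat.add_diff_assoc mod_add_self1 trans_le_add2)
      then show ?thesis using beta_digit_add[OF that] by simp
    qed
    then have Tm: "(beta_T ?t ^^ m) x = x"
      using beta_digit_inject[of ?t x "(beta_T ?t ^^ m) x"] beta_T_iterate_bounds[of x m ?t] x01
        golden_base_bounds by simp
    \<comment> \<open>With \<open>x = 1 / q\<close>, periodicity puts (\<tau>^m - 1)/q in Z[\<tau>];
      this number is \<open>?w\<close> below.\<close>
    obtain v where "golden_conj (x - ?t ^ m * x) (v - (1 - ?t) ^ m * x)"
      using golden_natural_extension[OF x01, of m] Tm by auto
    note w = golden_conj_mult[OF golden_conj_of_int[of "-1"] this]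
    let ?w = "of_int (-1) * (x - ?t ^ m * x)" and ?w' = "of_int (-1) * (v - (1 - ?t) ^ m * x)"
    have 1: "?t ^ m - 1 = real q * ?w" using assms(2) by (simp add: x_def field_simps)
    \<comment> \<open>The first component is 0, so the second is too, which carries equation
      \<open>1\<close> over to the conjugates.\<close>
    have "golden_conj ((?t ^ m - of_int 1) - of_int (int q) * ?w)
        (((1 - ?t) ^ m - of_int 1) - of_int (int q) * ?w')"
      by (intro golden_conj_diff golden_conj_mult golden_conj_of_int golden_conj_power golden_conj_base w)
    then have "golden_conj 0 (((1 - ?t) ^ m - 1) - real q * ?w')" using 1 by simp
    from golden_conj_0_left[OF this] have "(1 - ?t) ^ m - 1 = real q * ?w'" by simp
    with 1 w have "golden_dvd q (?t ^ m - 1) ((1 - ?t) ^ m - 1)" unfolding golden_dvd_def by blast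
    then show ?thesis
      using golden_dvd_base_order[OF n(2) minimal \<open>m \<ge> 1\<close>] assms(2) by (simp add: m_def)
  qed
  ultimately have short: "is_shortest_period (beta_digit ?t x) c"
    by (simp add: is_shortest_period_def c)
  have "(\<Sum>i=1..n. of_int (c ! (i - 1)) * ?t ^ (n - i)) = ?t ^ n * x - (1 - x)"
    unfolding beta_T_digit_sum[of ?t x n, unfolded Tn, symmetric]
    by (intro sum.cong) (auto simp: c)
  moreover have "(\<Sum>i=1..n. of_int (c ! (n + i - 1)) * ?t ^ (n - i)) = ?t ^ n * (1 - x) - x"
  proof -
    \<comment> \<open>The second half-period consists of the first \<open>n\<close> digits of
      \<open>1 - x\<close>, the \<open>n\<close>-th iterate of \<open>x\<close>.\<close>
    have "c ! (n + i - 1) = beta_digit ?t (1 - x) i" if "i \<in> {1..n}" for i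
      using that beta_digit_add[of i ?t x n] by (auto simp: c Tn)
    then have "(\<Sum>i=1..n. of_int (c ! (n + i - 1)) * ?t ^ (n - i))
        = (\<Sum>i=1..n. of_int (beta_digit ?t (1 - x) i) * ?t ^ (n - i))"
      by (intro sum.cong) auto
    then show ?thesis unfolding beta_T_digit_sum \<open>(beta_T ?t ^^ n) (1 - x) = x\<close> .
  qed
  ultimately have "(\<Sum>i=1..n. of_int (c ! (i - 1)) * ?t ^ (n - i)) +
      (\<Sum>i=1..n. of_int (c ! (n + i - 1)) * ?t ^ (n - i)) = ?t ^ n - 1"
    by (simp add: algebra_simps)
  then show ?thesis unfolding midy_property_def
    using short c(1) n(1) assms(2) by (intro exI[of _ 1] exI[of _ n] exI[of _ c]) (simp add: x_def)
qed

end
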